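(* In the integer-duration environment, there exists a choice of parameters $(\eta^*,\beta^* )$ such that the asymptotic competitive ratio of Forward-Looking BALANCE (FLB) with inspection-frequency scalar $\gamma^*=1$ and penalty parameters $(\eta^*,\beta^* )$ is at most $$\ln(RD)+\ln\ln(R\vee D)+O(1).$$
   Context: Online job assignment problem: there are $n$ servers $[n]$; server $i$ has capacity $c_i\in\mathbb{N}$, and $c_{\min}=\min_i c_i$. Over a continuous horizon $[0,T]$, $m$ jobs arrive online at times $0\le t_1\le\dots\le t_m\le T$. A set $E\subseteq[n]\times[m]$ specifies compatibility, $N(j)=\{i:(i,j)\in E\}$. Each $(i,j)\in E$ has a per-period reward $r_{ij}\in[1,R]$ and a duration $d_{ij}\in[1,D]$, where $R,D\ge1$ are known to the algorithm. The integer-duration environment is the special case where every $d_{ij}$ is an integer (arrival times and rewards may be real). When job $j$ arrives, $N(j)$ and $\{r_{ij},d_{ij}\}_{i\in N(j)}$ are revealed and the algorithm must immediately and irrevocably assign $j$ to a server in $N(j)$ or leave it unassigned. A job $j$ assigned to server $i$ occupies one unit of capacity of $i$ from time $t_j$ until $t_j+d_{ij}$ and yields reward $r_{ij}d_{ij}$. An assignment is feasible if at every time each server $i$ processes at most $c_i$ jobs. $\mathrm{OPT}(I)$ is the maximum total reward of a feasible assignment of instance $I$ computed knowing $I$ in advance; $\mathrm{ALG}(I)$ is the reward of online algorithm ALG. With $\mathcal I(R,D,c_{\min})$ the (here integer-duration) instances with rewards in $[1,R]$, durations in $[1,D]$ and minimum capacity $c_{\min}$, ALG is asymptotically $\Gamma(R,D)$-competitive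 if $\limsup_{c_{\min}\to\infty}\sup_{I\in\mathcal I(R,D,c_{\min})}\mathrm{OPT}(I)/\mathbb{E}[\mathrm{ALG}(I)]\le\Gamma(R,D)$. FLB with inspection-frequency scalar $\gamma\in[1,\infty)$ and penalty parameters $\eta\ge0,\beta\ge1$: let $\Psi(x)=\eta(\beta^{1-x}-1)$. For server $i$ and times $t\le\tau$, $\alpha_{i,t\to\tau}=1-\frac{1}{c_i}|\{j': t_{j'}<t,\ j'\text{ assigned to }i,\ t_{j'}+d_{ij'}>\tau\}|$. Let $\mathcal T_{ij}(\gamma)=\{\tau\in[t_j,t_j+d_{ij}):\tau=t_j+\ell/\gamma,\ \ell\in\mathbb{Z}_{\ge0}\}$. On arrival of job $j$, FLB computes for each $i\in N(j)$ the reduced reward $r_{ij}d_{ij}-\sum_{\tau\in\mathcal T_{ij}(\gamma)}\Psi(\alpha_{i,t_j\to\tau})$; if the maximum is positive it assigns $j$ to a maximizing server, otherwise $j$ is unassigned.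
   Formalization: Jobs with equal arrival times are processed in index order (α counts jobs before j, not only those with t_{j'}<t_j, which would be infeasible under ties); the bound is for R∨D ≥ K with any fixed K>1, the O(1) depending only on K, as ln ln(R∨D) is undefined or unbounded below near 1. *)

theory Defs
  imports "HOL-Probability.Probability"
begin

record job_instance =
  num_servers :: nat
  capacity :: "nat \<Rightarrow> nat"
  horizon :: real
  num_jobs :: nat
  arrival :: "nat \<Rightarrow> real"
  compat :: "(nat \<times> nat) set"
  rew :: "nat \<Rightarrow> nat \<Rightarrow> real"
  dur :: "nat \<Rightarrow> nat \<Rightarrow> real"

type_synonym assignment = "nat \<Rightarrow> nat option"

definition nbrs :: "job_instance \<Rightarrow> nat \<Rightarrow> nat set" where
  "nbrs I j = {i. (i, j) \<in> compat I}"

text \<open>Servers are \<open>1, \<dots>, n\<close> and jobs are \<open>1, \<dots>, m\<close>. The values of \<open>rew\<close> and \<open>dur\<close> outside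
  the compatibility relation are irrelevant. Capacities are positive integers.\<close>

definition valid_instance :: "job_instance \<Rightarrow> bool" where
  "valid_instance I \<longleftrightarrow>
     1 \<le> num_servers I \<and>
     (\<forall>i\<in>{1..num_servers I}. 1 \<le> capacity I i) \<and>
     0 \<le> horizon I \<and>
     (\<forall>j\<in>{1..num_jobs I}. 0 \<le> arrival I j \<and> arrival I j \<le> horizon I) \<and>
     (\<forall>j\<in>{1..num_jobs I}. \<forall>j'\<in>{1..num_jobs I}. j \<le> j' \<longrightarrow> arrival I j \<le> arrival I j') \<and>
     compat I \<subseteq> {1..num_servers I} \<times> {1..num_jobs I} \<and>
     (\<forall>(i, j)\<in>compat I. 1 \<le> rew I i j \<and> 1 \<le> dur I i j)"

definition min_capacity :: "job_instance \<Rightarrow> nat" where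
  "min_capacity I = Min (capacity I ` {1..num_servers I})"

definition instances :: "real \<Rightarrow> real \<Rightarrow> nat \<Rightarrow> job_instance set" where
  "instances R D c = {I. valid_instance I \<and> min_capacity I = c \<and>
     (\<forall>(i, j)\<in>compat I. rew I i j \<le> R \<and> dur I i j \<le> D)}"

definition integer_instances :: "real \<Rightarrow> real \<Rightarrow> nat \<Rightarrow> job_instance set" where
  "integer_instances R D c = {I \<in> instances R D c. \<forall>(i, j)\<in>compat I. dur I i j \<in> \<int>}"

definition feasible :: "job_instance \<Rightarrow> assignment \<Rightarrow> bool" where
  "feasible I a \<longleftrightarrow>
     (\<forall>i j. a j = Some i \<longrightarrow> i \<in> nbrs I j) \<and>
     (\<forall>i\<in>{1..num_servers I}. \<forall>s::real.
        card {j. a j = Some i \<and> arrival I j \<le> s \<and> s < arrival I j + dur I i j} \<le> capacity I i)"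

definition total_reward :: "job_instance \<Rightarrow> assignment \<Rightarrow> real" where
  "total_reward I a =
     (\<Sum>j\<in>{1..num_jobs I}. case a j of None \<Rightarrow> 0 | Some i \<Rightarrow> rew I i j * dur I i j)"

definition OPT :: "job_instance \<Rightarrow> real" where
  "OPT I = Max (total_reward I ` {a. feasible I a})"

text \<open>Algorithms may randomise. The quotient is taken in the extended reals, where \<open>0 / 0 = 0\<close>
  and \<open>x / 0 = \<infinity>\<close> for \<open>x > 0\<close>.\<close>

definition asymptotic_ratio ::
    "(nat \<Rightarrow> job_instance set) \<Rightarrow> (job_instance \<Rightarrow> assignment pmf) \<Rightarrow> ereal" where
  "asymptotic_ratio \<I> ALG =
     limsup (\<lambda>c. SUP I\<in>\<I> c.
       ereal (OPT I) / ereal (measure_pmf.expectation (ALG I) (total_reward I)))"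

text \<open>An algorithm must output feasible assignments on the whole instance class. This is not
  automatic for FLB: with \<open>\<eta> = 0\<close>, say, it ignores the capacities.\<close>

definition asymptotically_competitive ::
    "(nat \<Rightarrow> job_instance set) \<Rightarrow> (job_instance \<Rightarrow> assignment pmf) \<Rightarrow> real \<Rightarrow> bool" where
  "asymptotically_competitive \<I> ALG \<Gamma> \<longleftrightarrow>
     (\<forall>c. \<forall>I\<in>\<I> c. \<forall>a\<in>set_pmf (ALG I). feasible I a) \<and>
     asymptotic_ratio \<I> ALG \<le> ereal \<Gamma>"

definition penalty :: "real \<Rightarrow> real \<Rightarrow> real \<Rightarrow> real" where
  "penalty \<eta> \<beta> x = \<eta> * (\<beta> powr (1 - x) - 1)"

text \<open>The normalised capacity of server \<open>i\<close> available at time \<open>\<tau>\<close>, as seen when job \<open>j\<close> arrives.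
  Jobs with equal arrival times are processed in index order, so the jobs counted are those
  preceding \<open>j\<close>; for distinct arrival times these are the jobs with \<open>t\<^sub>j\<^sub>' < t\<^sub>j\<close>.\<close>

definition avail :: "job_instance \<Rightarrow> assignment \<Rightarrow> nat \<Rightarrow> nat \<Rightarrow> real \<Rightarrow> real" where
  "avail I a i j \<tau> = 1 - real (card {j'\<in>{1..<j}. a j' = Some i \<and> arrival I j' + dur I i j' > \<tau>})
     / real (capacity I i)"

definition inspection_times :: "real \<Rightarrow> job_instance \<Rightarrow> nat \<Rightarrow> nat \<Rightarrow> real set" where
  "inspection_times \<gamma> I i j =
     {\<tau>. arrival I j \<le> \<tau> \<and> \<tau> < arrival I j + dur I i j \<and> (\<exists>l::nat. \<tau> = arrival I j + real l / \<gamma>)}"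

definition reduced_reward ::
    "real \<Rightarrow> real \<Rightarrow> real \<Rightarrow> job_instance \<Rightarrow> assignment \<Rightarrow> nat \<Rightarrow> nat \<Rightarrow> real" where
  "reduced_reward \<gamma> \<eta> \<beta> I a i j =
     rew I i j * dur I i j - (\<Sum>\<tau>\<in>inspection_times \<gamma> I i j. penalty \<eta> \<beta> (avail I a i j \<tau>))"

definition FLB_step ::
    "real \<Rightarrow> real \<Rightarrow> real \<Rightarrow> job_instance \<Rightarrow> assignment \<Rightarrow> nat \<Rightarrow> nat option \<Rightarrow> bool" where
  "FLB_step \<gamma> \<eta> \<beta> I a j x \<longleftrightarrow>
     (case x of
        Some i \<Rightarrow> i \<in> nbrs I j \<and> 0 < reduced_reward \<gamma> \<eta> \<beta> I a i j \<and>
          (\<forall>i'\<in>nbrs I j. reduced_reward \<gamma> \<eta> \<beta> I a i' j \<le> reduced_reward \<gamma> \<eta> \<beta> I a i j)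
      | None \<Rightarrow> \<forall>i'\<in>nbrs I j. reduced_reward \<gamma> \<eta> \<beta> I a i' j \<le> 0)"

text \<open>Ties between maximising servers may be broken in any way, also at random. Indices outside
  \<open>1, \<dots>, m\<close> have no neighbours and hence stay unassigned.\<close>

definition is_FLB ::
    "real \<Rightarrow> real \<Rightarrow> real \<Rightarrow> (job_instance \<Rightarrow> assignment pmf) \<Rightarrow> bool" where
  "is_FLB \<gamma> \<eta> \<beta> ALG \<longleftrightarrow>
     (\<forall>I. valid_instance I \<longrightarrow> (\<forall>a\<in>set_pmf (ALG I). \<forall>j. FLB_step \<gamma> \<eta> \<beta> I a j (a j)))"

lemma FLB_run_exists:
  assumes "valid_instance I"
  shows "\<exists>a. \<forall>j. FLB_step \<gamma> \<eta> \<beta> I a j (a j)"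
proof (rule dependent_wf_choice[of less_than "\<lambda>a j x. FLB_step \<gamma> \<eta> \<beta> I a j x"])
  show "wf less_than" by simp
next
  fix f g :: assignment and x r
  assume eq: "\<And>z. (z, x) \<in> less_than \<Longrightarrow> f z = g z"
  have "avail I f i x \<tau> = avail I g i x \<tau>" for i \<tau>
  proof -
    have "{j'\<in>{1..<x}. f j' = Some i \<and> arrival I j' + dur I i j' > \<tau>} =
          {j'\<in>{1..<x}. g j' = Some i \<and> arrival I j' + dur I i j' > \<tau>}"
      using eq by auto
    then show ?thesis by (simp add: avail_def)
  qed
  then show "FLB_step \<gamma> \<eta> \<beta> I f x r = FLB_step \<gamma> \<eta> \<beta> I g x r"
    by (simp add: FLB_step_def reduced_reward_def split: option.split)
next
  fix j and a :: assignment
  let ?f = "\<lambda>i. reduced_reward \<gamma> \<eta> \<beta> I a i j"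
  have "nbrs I j \<subseteq> {1..num_servers I}"
    using assms by (auto simp: valid_instance_def nbrs_def)
  then have fin: "finite (nbrs I j)" by (rule finite_subset) simp
  show "\<exists>r. FLB_step \<gamma> \<eta> \<beta> I a j r"
  proof (cases "\<forall>i\<in>nbrs I j. ?f i \<le> 0")
    case True
    then have "FLB_step \<gamma> \<eta> \<beta> I a j None" by (simp add: FLB_step_def)
    then show ?thesis ..
  next
    case False
    then obtain i0 where i0: "i0 \<in> nbrs I j" "0 < ?f i0" by (auto simp: not_le)
    have "Max (?f ` nbrs I j) \<in> ?f ` nbrs I j" using fin i0 by (intro Max_in) auto
    then obtain i where i: "i \<in> nbrs I j" "?f i = Max (?f ` nbrs I j)" by auto
    then have mx: "?f i' \<le> ?f i" if "i' \<in> nbrs I j" for i' using that fin by simp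
    from mx[OF i0(1)] i0(2) have "0 < ?f i" by linarith
    with mx i(1) have "FLB_step \<gamma> \<eta> \<beta> I a j (Some i)" by (simp add: FLB_step_def)
    then show ?thesis ..
  qed
qed

lemma FLB_exists: "\<exists>ALG. is_FLB \<gamma> \<eta> \<beta> ALG"
proof -
  have "\<forall>I. \<exists>a. valid_instance I \<longrightarrow> (\<forall>j. FLB_step \<gamma> \<eta> \<beta> I a j (a j))"
    using FLB_run_exists by blast
  then obtain A where "\<And>I. valid_instance I \<Longrightarrow> \<forall>j. FLB_step \<gamma> \<eta> \<beta> I (A I) j (A I j)"
    by metis
  then have "is_FLB \<gamma> \<eta> \<beta> (\<lambda>I. return_pmf (A I))" by (simp add: is_FLB_def)
  then show ?thesis by blast
qed

end

theory Submission imports Defs begin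

text \<open>
  Dual fitting. The reduced rewards are the dual variables of the jobs. When FLB assigns job \<open>j\<close> to
  server \<open>i\<close>, put dual atoms on \<open>i\<close> at the times \<open>t\<^sub>j + 1, \<dots>, t\<^sub>j + d\<^sub>i\<^sub>j\<close>; the atom at
  \<open>t\<^sub>j + l + 1\<close> weighs as much as the increase of the penalty caused by one more job at the
  inspection time \<open>t\<^sub>j + l\<close>. Because durations are integers, a job running at time \<open>\<tau>\<close> has exactly
  one atom in \<open>(\<tau>, \<tau> + 1]\<close>, and by convexity of the penalty the atoms of all running jobs together
  weigh at least the penalty at \<open>\<tau>\<close>. So the dual is feasible, while an assignment increases it by
  at most about \<open>ln \<beta> (1 + \<eta>)\<close> times the reward collected. Capacities are respected once
  \<open>\<eta> (\<beta> - 1) \<ge> R D\<close>, and \<open>\<eta>\<close> of order \<open>1 / ln (R D)\<close> gives the bound.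
\<close>

section \<open>Finite sums and elementary inequalities\<close>

text \<open>In increasing order the elements of \<open>S\<close> have ranks 0, 1, 2, ..., so the sum
  telescopes. Removing the largest element leaves the ranks of the others unchanged. It serves to
  split a penalty among the jobs that cause it.\<close>

lemma sum_rank_telescope:
  fixes g :: "nat \<Rightarrow> real" and S :: "nat set"
  assumes "finite S"
  shows "(\<Sum>j\<in>S. g (Suc (card {k\<in>S. k < j})) - g (card {k\<in>S. k < j})) = g (card S) - g 0"
  using assms
proof (induction S rule: finite_linorder_max_induct)
  case empty
  then show ?case by simp
next
  case (insert b A)
  have "b \<notin> A" using insert by auto
  have b: "{k \<in> insert b A. k < b} = A" using insert by auto
  have "{k \<in> insert b A. k < j} = {k \<in> A. k < j}" if "j \<in> A" for j
    using insert that by auto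
  then have "(\<Sum>j\<in>A. g (Suc (card {k\<in>insert b A. k < j})) - g (card {k\<in>insert b A. k < j}))
      = g (card A) - g 0"
    using insert.IH by simp
  then show ?case using insert \<open>b \<notin> A\<close> b by simp
qed

lemma sum_option_fibers:
  fixes f :: "'a \<Rightarrow> 'b \<Rightarrow> real"
  assumes "finite A" "finite B" "\<And>i j. j \<in> A \<Longrightarrow> a j = Some i \<Longrightarrow> i \<in> B"
  shows "(\<Sum>j\<in>A. case a j of None \<Rightarrow> 0 | Some i \<Rightarrow> f i j)
    = (\<Sum>i\<in>B. \<Sum>j\<in>{j\<in>A. a j = Some i}. f i j)"
proof -
  have "(\<Sum>i\<in>B. \<Sum>j\<in>{j\<in>A. a j = Some i}. f i j)
      = (\<Sum>i\<in>B. \<Sum>j\<in>A. if a j = Some i then f i j else 0)"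
    using assms(1) by (simp add: sum.inter_filter)
  also have "\<dots> = (\<Sum>j\<in>A. \<Sum>i\<in>B. if a j = Some i then f i j else 0)"
    by (rule sum.swap)
  also have "\<dots> = (\<Sum>j\<in>A. case a j of None \<Rightarrow> 0 | Some i \<Rightarrow> f i j)"
  proof (rule sum.cong)
    fix j assume j: "j \<in> A"
    show "(\<Sum>i\<in>B. if a j = Some i then f i j else 0) = (case a j of None \<Rightarrow> 0 | Some i \<Rightarrow> f i j)"
    proof (cases "a j")
      case (Some i)
      then show ?thesis using assms(2) assms(3)[OF j Some] by simp
    qed simp
  qed simp
  finally show ?thesis by simp
qed

lemma sum_rotate:
  fixes f :: "'a \<Rightarrow> 'b \<Rightarrow> 'c \<Rightarrow> 'd::comm_monoid_add"
  shows "(\<Sum>x\<in>A. \<Sum>y\<in>B. \<Sum>z\<in>C y. f x y z) = (\<Sum>y\<in>B. \<Sum>z\<in>C y. \<Sum>x\<in>A. f x y z)"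
  by (subst sum.swap) (intro sum.cong refl sum.swap)

lemma sum_of_bool_unit_windows:
  fixes t p :: real
  shows "(\<Sum>k<n. of_bool (t + real k < p \<and> p \<le> t + real k + 1) :: real)
    = of_bool (t < p \<and> p \<le> t + real n)"
  by (induction n) (auto simp: of_bool_def)

lemma convex_power_increment:
  fixes x :: real
  assumes "1 \<le> x" "m \<le> n"
  shows "x ^ Suc m - x ^ m \<le> x ^ Suc n - x ^ n"
proof -
  have "(x - 1) * x ^ m \<le> (x - 1) * x ^ n"
    using assms by (intro mult_left_mono power_increasing) auto
  then show ?thesis by (simp add: algebra_simps)
qed

lemma exp_diff_one_le: "exp x - 1 \<le> x * exp (x::real)"
proof -
  have "(1 - x) * exp x \<le> exp (- x) * exp x"
    using exp_ge_add_one_self[of "-x"] by (intro mult_right_mono) auto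
  then show ?thesis by (simp add: algebra_simps flip: exp_add)
qed

section \<open>Feasible assignments\<close>

lemma finite_feasible:
  assumes "valid_instance I"
  shows "finite {a. feasible I a}"
proof (rule finite_subset)
  let ?F = "{f :: nat \<Rightarrow> nat option. \<forall>x. (x \<in> {1..num_jobs I} \<longrightarrow>
    f x \<in> insert None (Some ` {1..num_servers I})) \<and> (x \<notin> {1..num_jobs I} \<longrightarrow> f x = None)}"
  have "a x \<in> insert None (Some ` {1..num_servers I}) \<and> (x \<notin> {1..num_jobs I} \<longrightarrow> a x = None)"
    if "feasible I a" for a x
  proof (cases "a x")
    case (Some i)
    then have "(i, x) \<in> compat I" using that by (auto simp: feasible_def nbrs_def)
    then show ?thesis using assms Some by (fastforce simp: valid_instance_def)
  qed simp
  then show "{a. feasible I a} \<subseteq> ?F" by blast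
  show "finite ?F" by (rule finite_set_of_finite_funs) auto
qed

lemma feasible_None: "feasible I (\<lambda>_. None)"
  by (simp add: feasible_def)

lemma finite_assigned:
  assumes "valid_instance I" "\<And>i j. a j = Some i \<Longrightarrow> i \<in> nbrs I j"
  shows "finite {j. a j = Some i \<and> P j}"
proof (rule finite_subset)
  show "{j. a j = Some i \<and> P j} \<subseteq> {1..num_jobs I}"
    using assms by (fastforce simp: nbrs_def valid_instance_def)
qed simp

text \<open>\<open>feasible\<close> counts a job on \<open>[t, t + d)\<close>, the dual prices count
  it on \<open>(t, t + d]\<close>. Moving from \<open>p\<close> back to the last arrival among the
  counted jobs bridges the two conventions: all of them are running at that moment.\<close>

lemma feasible_left_limit:
  assumes "valid_instance I" "feasible I a" "i \<in> {1..num_servers I}"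
  shows "card {j. a j = Some i \<and> arrival I j < p \<and> p \<le> arrival I j + dur I i j} \<le> capacity I i"
    (is "card ?F \<le> _")
proof (cases "?F = {}")
  case False
  have fin: "finite {j. a j = Some i \<and> P j}" for P
    using assms by (intro finite_assigned) (auto simp: feasible_def)
  define s where "s = Max (arrival I ` ?F)"
  have "s \<in> arrival I ` ?F" unfolding s_def using False fin by (intro Max_in) auto
  then have "s < p" by auto
  moreover have "arrival I j \<le> s" if "j \<in> ?F" for j
    unfolding s_def using fin that by (intro Max_ge) auto
  ultimately have "?F \<subseteq> {j. a j = Some i \<and> arrival I j \<le> s \<and> s < arrival I j + dur I i j}"
    by fastforce
  then have "card ?F \<le> card {j. a j = Some i \<and> arrival I j \<le> s \<and> s < arrival I j + dur I i j}"
    using fin by (intro card_mono) auto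
  also have "\<dots> \<le> capacity I i" using assms by (auto simp: feasible_def)
  finally show ?thesis .
next
  case True
  then show ?thesis by (simp only: card.empty le0)
qed

section \<open>One run of FLB and its dual prices\<close>

text \<open>A single outcome \<open>a\<close> is fixed, so the bounds hold for every outcome
  separately. By \<open>saturation\<close>, a full server costs at least \<open>R * D\<close>, the
  largest possible reward, at a single inspection time.\<close>

locale flb_run =
  fixes I :: job_instance and a :: assignment and \<eta> \<beta> R D :: real
  assumes valid: "valid_instance I"
    and bounds: "\<And>i j. (i, j) \<in> compat I \<Longrightarrow> rew I i j \<le> R \<and> dur I i j \<le> D"
    and integral: "\<And>i j. (i, j) \<in> compat I \<Longrightarrow> dur I i j \<in> \<int>"
    and step: "\<And>j. FLB_step 1 \<eta> \<beta> I a j (a j)"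
    and eta_pos: "0 < \<eta>" and beta_ge_1: "1 \<le> \<beta>"
    and saturation: "R * D \<le> \<eta> * (\<beta> - 1)"
begin

definition load :: "nat \<Rightarrow> nat \<Rightarrow> real \<Rightarrow> nat" where
  "load i j \<tau> = card {j'\<in>{1..<j}. a j' = Some i \<and> arrival I j' + dur I i j' > \<tau>}"

text \<open>With this base the penalty at load \<open>N\<close> is
  \<open>\<eta> * (root_beta i ^ N - 1)\<close>, whose increments grow with
  \<open>N\<close>.\<close>

definition root_beta :: "nat \<Rightarrow> real" where
  "root_beta i = \<beta> powr (1 / real (capacity I i))"

definition units :: "nat \<Rightarrow> nat \<Rightarrow> nat" where
  "units i j = nat \<lfloor>dur I i j\<rfloor>"

definition atom_weight :: "nat \<Rightarrow> nat \<Rightarrow> nat \<Rightarrow> real" where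
  "atom_weight i j l = (let N = load i j (arrival I j + real l) in
     \<eta> * (root_beta i ^ Suc N - root_beta i ^ N))"

text \<open>The dual price of the half-open interval \<open>(s, e]\<close> on server \<open>i\<close>. A job carries its atoms at
  the \<^emph>\<open>ends\<close> of its unit pieces, so that every unit window starting while it runs contains
  exactly one of them.\<close>

definition price :: "nat \<Rightarrow> real \<Rightarrow> real \<Rightarrow> real" where
  "price i s e = (\<Sum>j\<in>{j\<in>{1..num_jobs I}. a j = Some i}. \<Sum>l<units i j.
     atom_weight i j l * of_bool (s < arrival I j + real l + 1 \<and> arrival I j + real l + 1 \<le> e))"

text \<open>By the greedy rule this is the positive part of the largest reduced reward of
  \<open>j\<close>.\<close>

definition surplus :: "nat \<Rightarrow> real" where
  "surplus j = (case a j of None \<Rightarrow> 0 | Some i \<Rightarrow> reduced_reward 1 \<eta> \<beta> I a i j)"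

lemma assigned_compat: "a j = Some i \<Longrightarrow> (i, j) \<in> compat I"
  using step[of j] by (simp add: FLB_step_def nbrs_def)

lemma compatD:
  assumes "(i, j) \<in> compat I"
  shows "i \<in> {1..num_servers I}" "j \<in> {1..num_jobs I}" "1 \<le> rew I i j" "1 \<le> dur I i j"
    "1 \<le> capacity I i"
  using valid assms by (fastforce simp: valid_instance_def)+

lemma arrival_mono:
  "j \<in> {1..num_jobs I} \<Longrightarrow> j' \<in> {1..num_jobs I} \<Longrightarrow> j \<le> j' \<Longrightarrow> arrival I j \<le> arrival I j'"
  using valid by (auto simp: valid_instance_def)

lemma dur_eq_units:
  assumes "(i, j) \<in> compat I"
  shows "dur I i j = real (units i j)"
  using integral[OF assms] compatD(4)[OF assms] by (auto simp: units_def elim!: Ints_cases)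

lemma inspection_times_eq:
  assumes "(i, j) \<in> compat I"
  shows "inspection_times 1 I i j = (\<lambda>l. arrival I j + real l) ` {..<units i j}"
  unfolding inspection_times_def dur_eq_units[OF assms] by auto

lemma root_beta_ge_1: "1 \<le> root_beta i"
  using beta_ge_1 by (simp add: root_beta_def ge_one_powr_ge_zero)

lemma penalty_avail:
  "penalty \<eta> \<beta> (avail I a i j \<tau>) = \<eta> * (root_beta i ^ load i j \<tau> - 1)"
proof -
  have "root_beta i ^ load i j \<tau> = \<beta> powr (real (load i j \<tau>) / real (capacity I i))"
    using beta_ge_1 by (simp add: root_beta_def powr_powr flip: powr_realpow)
  then show ?thesis by (simp add: penalty_def avail_def load_def)
qed

lemma reduced_reward_eq:
  assumes "(i, j) \<in> compat I"
  shows "reduced_reward 1 \<eta> \<beta> I a i j = rew I i j * dur I i j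
    - (\<Sum>l<units i j. \<eta> * (root_beta i ^ load i j (arrival I j + real l) - 1))"
  unfolding reduced_reward_def inspection_times_eq[OF assms]
  by (subst sum.reindex) (auto simp: inj_on_def penalty_avail)

lemma atom_weight_nonneg: "0 \<le> atom_weight i j l"
proof -
  have "root_beta i ^ load i j (arrival I j + real l)
      \<le> root_beta i ^ Suc (load i j (arrival I j + real l))"
    using root_beta_ge_1 by (intro power_increasing) auto
  then show ?thesis
    using eta_pos by (simp add: atom_weight_def Let_def)
qed

section \<open>Capacity constraints of the run\<close>

text \<open>On a full server the inspection at the arrival time alone, \<open>l = 0\<close>, costs
  \<open>\<eta> * (\<beta> - 1)\<close>. By \<open>saturation\<close> this outweighs the reward, and
  the other penalties are nonnegative, so FLB would not have chosen the server.\<close>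

lemma load_less_capacity:
  assumes "a j = Some i"
  shows "load i j (arrival I j) < capacity I i"
proof (rule ccontr)
  assume "\<not> ?thesis"
  then have full: "capacity I i \<le> load i j (arrival I j)" by simp
  note c = assigned_compat[OF assms]
  have u: "0 < units i j" using dur_eq_units[OF c] compatD(4)[OF c] by auto
  have "\<beta> = root_beta i ^ capacity I i"
    using beta_ge_1 compatD(5)[OF c] by (simp add: root_beta_def powr_powr flip: powr_realpow)
  also have "\<dots> \<le> root_beta i ^ load i j (arrival I j)"
    using full root_beta_ge_1 by (intro power_increasing) auto
  finally have "\<eta> * (\<beta> - 1) \<le> \<eta> * (root_beta i ^ load i j (arrival I j + real 0) - 1)"
    using eta_pos by simp
  also have "\<dots> \<le> (\<Sum>l<units i j. \<eta> * (root_beta i ^ load i j (arrival I j + real l) - 1))"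
    using u eta_pos root_beta_ge_1
    by (intro member_le_sum[of 0 _ "\<lambda>l. \<eta> * (root_beta i ^ load i j (arrival I j + real l) - 1)"])
      (auto simp: one_le_power)
  finally have "R * D \<le> (\<Sum>l<units i j. \<eta> * (root_beta i ^ load i j (arrival I j + real l) - 1))"
    using saturation by linarith
  moreover have "rew I i j * dur I i j \<le> R * D"
    using bounds[OF c] compatD[OF c] by (intro mult_mono) auto
  ultimately have "reduced_reward 1 \<eta> \<beta> I a i j \<le> 0"
    using reduced_reward_eq[OF c] by linarith
  then show False using step[of j] assms by (simp add: FLB_step_def)
qed

lemma feasible_run: "feasible I a"
  unfolding feasible_def
proof (intro conjI allI impI ballI)
  fix i j assume "a j = Some i"
  then show "i \<in> nbrs I j" using assigned_compat by (simp add: nbrs_def)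
next
  fix i s assume i: "i \<in> {1..num_servers I}"
  let ?A = "{j. a j = Some i \<and> arrival I j \<le> s \<and> s < arrival I j + dur I i j}"
  show "card ?A \<le> capacity I i"
  proof (cases "?A = {}")
    case False
    have fin: "finite ?A"
      using valid assigned_compat by (intro finite_assigned) (auto simp: nbrs_def)
    \<comment> \<open>Every other job running at \<open>s\<close> has a smaller index than
      \<open>j\<close> and is still running when \<open>j\<close> arrives, as
      \<open>arrival I j \<le> s\<close>; hence it is counted in the load seen by
      \<open>j\<close>.\<close>
    define j where "j = Max ?A"
    have j: "j \<in> ?A" unfolding j_def using fin False by (rule Max_in)
    let ?B = "{j'\<in>{1..<j}. a j' = Some i \<and> arrival I j' + dur I i j' > arrival I j}"
    have "?A \<subseteq> insert j ?B"
    proof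
      fix k assume k: "k \<in> ?A"
      then have "k \<le> j" unfolding j_def using fin by simp
      moreover have "1 \<le> k" using compatD(2)[OF assigned_compat] k by force
      ultimately show "k \<in> insert j ?B" using k j by auto
    qed
    then have "card ?A \<le> card (insert j ?B)" by (intro card_mono) auto
    also have "\<dots> = Suc (load i j (arrival I j))" by (simp add: load_def)
    also have "\<dots> \<le> capacity I i" using load_less_capacity[of j i] j by simp
    finally show ?thesis .
  next
    case True
    then show ?thesis by (simp only: card.empty le0)
  qed
qed

section \<open>Dual feasibility\<close>

text \<open>The penalty is telescoped over the jobs in \<open>load i j \<tau>\<close>, ranked by
  index. Each job pays for its increment with its atom in the window: the load it saw at the
  matching inspection time was at least its rank, and increments grow with the load.\<close>

lemma penalty_le_window_price:
  assumes j: "j \<in> {1..num_jobs I}" and \<tau>: "arrival I j \<le> \<tau>"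
  shows "\<eta> * (root_beta i ^ load i j \<tau> - 1) \<le> price i \<tau> (\<tau> + 1)"
proof -
  let ?S = "{j'\<in>{1..<j}. a j' = Some i \<and> arrival I j' + dur I i j' > \<tau>}"
  let ?J = "{j'\<in>{1..num_jobs I}. a j' = Some i}"
  let ?rank = "\<lambda>k. card {k'\<in>?S. k' < k}"
  let ?w = "\<lambda>k l. atom_weight i k l *
    of_bool (\<tau> < arrival I k + real l + 1 \<and> arrival I k + real l + 1 \<le> \<tau> + 1)"
  have "\<eta> * (root_beta i ^ load i j \<tau> - 1)
      = (\<Sum>k\<in>?S. \<eta> * root_beta i ^ Suc (?rank k) - \<eta> * root_beta i ^ ?rank k)"
    by (subst sum_rank_telescope) (simp_all add: load_def right_diff_distrib)
  also have "\<dots> \<le> (\<Sum>k\<in>?S. \<Sum>l<units i k. ?w k l)"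
  proof (rule sum_mono)
    fix k assume k: "k \<in> ?S"
    then have c: "(i, k) \<in> compat I" using assigned_compat by simp
    have "arrival I k \<le> arrival I j" using k compatD(2)[OF c] j by (intro arrival_mono) auto
    then have le: "arrival I k \<le> \<tau>" using \<tau> by simp
    \<comment> \<open>\<open>l\<close> numbers the unit piece of job \<open>k\<close> that contains
      \<open>\<tau>\<close>; the end of this piece is the atom in
      \<open>(\<tau>, \<tau> + 1]\<close>. As the duration equals the integer
      \<open>units i k\<close>, the piece is a complete one.\<close>
    define l where "l = nat \<lfloor>\<tau> - arrival I k\<rfloor>"
    have l: "real l \<le> \<tau> - arrival I k" "\<tau> - arrival I k < real l + 1"
      using le by (simp_all add: l_def)
    have lu: "l < units i k" using k dur_eq_units[OF c] l by auto
    \<comment> \<open>The inspection time \<open>arrival I k + real l\<close> is at most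
      \<open>\<tau>\<close>, so every job running beyond \<open>\<tau>\<close> also runs beyond
      it.\<close>
    have "?rank k \<le> load i k (arrival I k + real l)"
      unfolding load_def using l k by (intro card_mono) auto
    then have "root_beta i ^ Suc (?rank k) - root_beta i ^ ?rank k
        \<le> root_beta i ^ Suc (load i k (arrival I k + real l))
          - root_beta i ^ load i k (arrival I k + real l)"
      using root_beta_ge_1 by (rule convex_power_increment[rotated])
    then have "\<eta> * root_beta i ^ Suc (?rank k) - \<eta> * root_beta i ^ ?rank k \<le> atom_weight i k l"
      using eta_pos unfolding atom_weight_def Let_def right_diff_distrib[symmetric] by simp
    also have "\<dots> = ?w k l" using l by simp
    also have "\<dots> \<le> (\<Sum>l<units i k. ?w k l)"
      using lu atom_weight_nonneg by (intro member_le_sum[of l _ "?w k"]) auto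
    finally show "\<eta> * root_beta i ^ Suc (?rank k) - \<eta> * root_beta i ^ ?rank k
        \<le> (\<Sum>l<units i k. ?w k l)" .
  qed
  \<comment> \<open>\<open>price\<close> also contains the atoms of jobs that come later than
    \<open>j\<close> or have ended by \<open>\<tau>\<close>; being nonnegative, they can only
    increase it.\<close>
  also have "\<dots> \<le> (\<Sum>k\<in>?J. \<Sum>l<units i k. ?w k l)"
    using j atom_weight_nonneg by (intro sum_mono2) (auto intro!: sum_nonneg)
  finally show ?thesis by (simp add: price_def)
qed

text \<open>The duration being an integer, the unit windows that start at the inspection times tile
  \<open>(t, t + d]\<close> exactly, so the window prices add up to the price of the whole
  interval.\<close>

lemma sum_penalty_le_price:
  assumes c: "(i, j) \<in> compat I"
  shows "(\<Sum>l<units i j. \<eta> * (root_beta i ^ load i j (arrival I j + real l) - 1))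
    \<le> price i (arrival I j) (arrival I j + dur I i j)"
proof -
  let ?J = "{j'\<in>{1..num_jobs I}. a j' = Some i}"
  let ?in = "\<lambda>m k l. of_bool (arrival I j + real m < arrival I k + real l + 1
      \<and> arrival I k + real l + 1 \<le> arrival I j + real m + 1) :: real"
  have "(\<Sum>l<units i j. \<eta> * (root_beta i ^ load i j (arrival I j + real l) - 1))
      \<le> (\<Sum>m<units i j. price i (arrival I j + real m) (arrival I j + real m + 1))"
    using compatD(2)[OF c] by (intro sum_mono penalty_le_window_price) auto
  also have "\<dots> = (\<Sum>k\<in>?J. \<Sum>l<units i k. \<Sum>m<units i j. atom_weight i k l * ?in m k l)"
    unfolding price_def
    by (rule sum_rotate)
  also have "\<dots> = (\<Sum>k\<in>?J. \<Sum>l<units i k. atom_weight i k l * (\<Sum>m<units i j. ?in m k l))"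
    by (simp only: sum_distrib_left)
  also have "\<dots> = price i (arrival I j) (arrival I j + dur I i j)"
    unfolding sum_of_bool_unit_windows price_def dur_eq_units[OF c] ..
  finally show ?thesis .
qed

lemma surplus_nonneg: "0 \<le> surplus j"
  using step[of j] by (auto simp: surplus_def FLB_step_def split: option.splits)

lemma reduced_reward_le_surplus:
  assumes "(i, j) \<in> compat I"
  shows "reduced_reward 1 \<eta> \<beta> I a i j \<le> surplus j"
  using step[of j] assms by (auto simp: surplus_def FLB_step_def nbrs_def split: option.splits)

text \<open>The dual constraint of the pair: the reward is the reduced reward, bounded by greedy
  choice, plus the penalties, bounded by the atoms.\<close>

lemma dual_feasible:
  assumes "(i, j) \<in> compat I"
  shows "rew I i j * dur I i j \<le> surplus j + price i (arrival I j) (arrival I j + dur I i j)"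
  using reduced_reward_le_surplus[OF assms] reduced_reward_eq[OF assms]
    sum_penalty_le_price[OF assms] by linarith

section \<open>Dual objective and weak duality\<close>

text \<open>Double counting over atoms: an atom at \<open>p\<close> is charged to the jobs of
  \<open>b\<close> whose interval contains \<open>p\<close>, and feasibility of \<open>b\<close>
  permits at most \<open>capacity I i\<close> of them.\<close>

lemma sum_price_le:
  assumes b: "feasible I b" and i: "i \<in> {1..num_servers I}"
  shows "(\<Sum>j\<in>{j\<in>{1..num_jobs I}. b j = Some i}. price i (arrival I j) (arrival I j + dur I i j))
    \<le> (\<Sum>k\<in>{k\<in>{1..num_jobs I}. a k = Some i}. real (capacity I i) * (\<Sum>l<units i k. atom_weight i k l))"
    (is "?L \<le> ?R")
proof -
  let ?B = "{j\<in>{1..num_jobs I}. b j = Some i}"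
  let ?J = "{k\<in>{1..num_jobs I}. a k = Some i}"
  let ?in = "\<lambda>j p. of_bool (arrival I j < p \<and> p \<le> arrival I j + dur I i j) :: real"
  have "?L = (\<Sum>k\<in>?J. \<Sum>l<units i k. \<Sum>j\<in>?B. atom_weight i k l * ?in j (arrival I k + real l + 1))"
    unfolding price_def
    by (rule sum_rotate)
  also have "\<dots> = (\<Sum>k\<in>?J. \<Sum>l<units i k. atom_weight i k l *
      (\<Sum>j\<in>?B. ?in j (arrival I k + real l + 1)))"
    by (simp only: sum_distrib_left)
  also have "\<dots> \<le> (\<Sum>k\<in>?J. \<Sum>l<units i k. atom_weight i k l * real (capacity I i))"
  proof (intro sum_mono mult_left_mono atom_weight_nonneg)
    fix k l
    let ?p = "arrival I k + real l + 1"
    have "(\<Sum>j\<in>?B. ?in j ?p)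
        = real (card (?B \<inter> {j. arrival I j < ?p \<and> ?p \<le> arrival I j + dur I i j}))"
      by (simp add: of_bool_def sum.If_cases)
    also have "\<dots> \<le> real (card {j. b j = Some i \<and> arrival I j < ?p \<and> ?p \<le> arrival I j + dur I i j})"
      using finite_assigned[OF valid, of b] b
      by (intro of_nat_mono card_mono) (auto simp: feasible_def)
    also have "\<dots> \<le> real (capacity I i)"
      using feasible_left_limit[OF valid b i] by (intro of_nat_mono)
    finally show "(\<Sum>j\<in>?B. ?in j ?p) \<le> real (capacity I i)" .
  qed
  also have "\<dots> = ?R" by (simp add: sum_distrib_left mult.commute)
  finally show ?thesis .
qed

text \<open>The left side is the difference quotient of \<open>\<beta> powr x\<close> at 0 with step
  \<open>1 / capacity\<close>, which tends to \<open>ln \<beta>\<close>. The factor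
  \<open>\<beta> powr (1 / c)\<close> controls the error uniformly over the servers; large
  capacities enter here.\<close>

lemma capacity_root_beta:
  assumes "1 \<le> c" "c \<le> capacity I i"
  shows "real (capacity I i) * (root_beta i - 1) \<le> ln \<beta> * \<beta> powr (1 / real c)"
proof -
  let ?C = "real (capacity I i)"
  have C: "0 < ?C" using assms by simp
  have rb: "root_beta i = exp (ln \<beta> / ?C)" using beta_ge_1 by (simp add: root_beta_def powr_def)
  have "?C * (root_beta i - 1) \<le> ?C * (ln \<beta> / ?C * exp (ln \<beta> / ?C))"
    unfolding rb using C by (intro mult_left_mono exp_diff_one_le) auto
  also have "\<dots> = ln \<beta> * \<beta> powr (1 / ?C)" using C rb by (simp add: root_beta_def)
  also have "\<dots> \<le> ln \<beta> * \<beta> powr (1 / real c)"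
    using assms beta_ge_1 C by (intro mult_left_mono powr_mono) (auto simp: frac_le)
  finally show ?thesis .
qed

text \<open>The left side is the share of the dual objective charged to \<open>j\<close>. An atom
  times the capacity is at most \<open>\<kappa>\<close> times the penalty plus \<open>\<eta>\<close>
  at its inspection time. The extra terms sum to \<open>\<eta> * dur I i j\<close>, at most
  \<open>\<eta>\<close> times the reward because \<open>rew\<close> is at least 1.\<close>

lemma dual_increment_le:
  assumes j: "a j = Some i" and \<kappa>: "1 \<le> \<kappa>" "real (capacity I i) * (root_beta i - 1) \<le> \<kappa>"
  shows "reduced_reward 1 \<eta> \<beta> I a i j + real (capacity I i) * (\<Sum>l<units i j. atom_weight i j l)
    \<le> \<kappa> * (1 + \<eta>) * (rew I i j * dur I i j)"
proof -
  note c = assigned_compat[OF j]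
  let ?N = "\<lambda>l. load i j (arrival I j + real l)"
  let ?V = "rew I i j * dur I i j"
  define P where "P = (\<Sum>l<units i j. \<eta> * (root_beta i ^ ?N l - 1))"
  have rr: "reduced_reward 1 \<eta> \<beta> I a i j = ?V - P"
    using reduced_reward_eq[OF c] by (simp add: P_def)
  have pos: "P < ?V" using step[of j] j rr by (simp add: FLB_step_def)
  have "real (capacity I i) * (\<Sum>l<units i j. atom_weight i j l)
      = (\<Sum>l<units i j. real (capacity I i) * (root_beta i - 1) * (\<eta> * root_beta i ^ ?N l))"
    by (simp add: atom_weight_def Let_def sum_distrib_left algebra_simps)
  also have "\<dots> \<le> (\<Sum>l<units i j. \<kappa> * (\<eta> * root_beta i ^ ?N l))"
    using \<kappa>(2) eta_pos root_beta_ge_1[of i] by (intro sum_mono mult_right_mono) auto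
  also have "\<dots> = \<kappa> * (P + \<eta> * dur I i j)"
    unfolding P_def dur_eq_units[OF c]
    by (simp add: sum_distrib_left sum_subtractf algebra_simps)
  finally have 1: "real (capacity I i) * (\<Sum>l<units i j. atom_weight i j l)
    \<le> \<kappa> * (P + \<eta> * dur I i j)" .
  have "dur I i j \<le> ?V" using compatD[OF c] by simp
  then have 2: "\<kappa> * (\<eta> * dur I i j) \<le> \<kappa> * (\<eta> * ?V)"
    using \<kappa>(1) eta_pos by (intro mult_left_mono) auto
  \<comment> \<open>The reduced reward \<open>?V - P\<close> is positive, so it may be enlarged by
    the factor \<open>\<kappa>\<close>; then the penalties \<open>P\<close> cancel.\<close>
  have "0 \<le> (\<kappa> - 1) * (?V - P)" using \<kappa>(1) pos by simp
  then show ?thesis using 1 2 rr by (simp add: algebra_simps)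
qed

text \<open>Weak duality: the dual constraints bound the reward of \<open>b\<close> by the dual
  objective, which is then charged job by job to \<open>a\<close>. Here \<open>\<kappa>\<close>
  stands for \<open>ln \<beta>\<close> up to a factor tending to 1.\<close>

theorem competitive:
  assumes b: "feasible I b" and \<kappa>: "1 \<le> \<kappa>"
    and cap: "\<And>i. i \<in> {1..num_servers I} \<Longrightarrow> real (capacity I i) * (root_beta i - 1) \<le> \<kappa>"
  shows "total_reward I b \<le> \<kappa> * (1 + \<eta>) * total_reward I a"
proof -
  let ?M = "{1..num_jobs I}" and ?S = "{1..num_servers I}"
  let ?inc = "\<lambda>i j. real (capacity I i) * (\<Sum>l<units i j. atom_weight i j l)"
  have bc: "(i, j) \<in> compat I" if "b j = Some i" for i j
    using b that by (auto simp: feasible_def nbrs_def)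
  have "total_reward I b \<le> (\<Sum>j\<in>?M. surplus j + (case b j of None \<Rightarrow> 0 |
      Some i \<Rightarrow> price i (arrival I j) (arrival I j + dur I i j)))"
    unfolding total_reward_def
    by (intro sum_mono) (auto split: option.split intro: surplus_nonneg dual_feasible bc)
  also have "\<dots> = (\<Sum>j\<in>?M. surplus j) + (\<Sum>i\<in>?S. \<Sum>j\<in>{j\<in>?M. b j = Some i}.
      price i (arrival I j) (arrival I j + dur I i j))"
    using compatD(1)[OF bc] by (simp only: sum.distrib, subst sum_option_fibers[of _ ?S]) auto
  also have "\<dots> \<le> (\<Sum>j\<in>?M. surplus j) + (\<Sum>i\<in>?S. \<Sum>j\<in>{j\<in>?M. a j = Some i}. ?inc i j)"
    using b by (intro add_left_mono sum_mono sum_price_le)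
  also have "\<dots> = (\<Sum>j\<in>?M. surplus j + (case a j of None \<Rightarrow> 0 | Some i \<Rightarrow> ?inc i j))"
    using compatD(1)[OF assigned_compat]
    by (simp only: sum.distrib, subst sum_option_fibers[of _ ?S]) auto
  also have "\<dots> \<le> (\<Sum>j\<in>?M. \<kappa> * (1 + \<eta>) *
      (case a j of None \<Rightarrow> 0 | Some i \<Rightarrow> rew I i j * dur I i j))"
  proof (rule sum_mono)
    fix j
    show "surplus j + (case a j of None \<Rightarrow> 0 | Some i \<Rightarrow> ?inc i j) \<le> \<kappa> * (1 + \<eta>) *
      (case a j of None \<Rightarrow> 0 | Some i \<Rightarrow> rew I i j * dur I i j)"
    proof (cases "a j")
      case (Some i)
      then show ?thesis
        using dual_increment_le[OF Some \<kappa> cap] compatD(1)[OF assigned_compat[OF Some]]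
        by (simp add: surplus_def)
    qed (simp add: surplus_def)
  qed
  also have "\<dots> = \<kappa> * (1 + \<eta>) * total_reward I a"
    by (simp add: total_reward_def sum_distrib_left)
  finally show ?thesis .
qed

end

section \<open>Expectations and the limit of large capacities\<close>

lemma flb_run_of_integer_instance:
  assumes "is_FLB 1 \<eta> \<beta> ALG" "I \<in> integer_instances R D c" "a \<in> set_pmf (ALG I)"
    and "0 < \<eta>" "1 \<le> \<beta>" "R * D \<le> \<eta> * (\<beta> - 1)"
  shows "flb_run I a \<eta> \<beta> R D"
  using assms by unfold_locales (auto simp: integer_instances_def instances_def is_FLB_def)

lemma FLB_instance_ratio:
  assumes FLB: "is_FLB 1 \<eta> \<beta> ALG" and I: "I \<in> integer_instances R D c"
    and par: "0 < \<eta>" "exp 1 \<le> \<beta>" "R * D \<le> \<eta> * (\<beta> - 1)"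
  shows "ereal (OPT I) / ereal (measure_pmf.expectation (ALG I) (total_reward I))
    \<le> ereal (ln \<beta> * \<beta> powr (1 / real c) * (1 + \<eta>))"
proof -
  define \<Gamma> where "\<Gamma> = ln \<beta> * \<beta> powr (1 / real c) * (1 + \<eta>)"
  define E where "E = measure_pmf.expectation (ALG I) (total_reward I)"
  have \<beta>1: "1 \<le> \<beta>" using par(2) exp_ge_add_one_self[of 1] by linarith
  \<comment> \<open>This is the purpose of \<open>exp 1 \<le> \<beta>\<close>: it yields the
    condition \<open>1 \<le> \<kappa>\<close> of \<open>competitive\<close>.\<close>
  have \<beta>: "1 \<le> ln \<beta>" using par(2) \<beta>1 ln_ge_iff[of \<beta> 1] by simp
  have "1 * 1 \<le> ln \<beta> * \<beta> powr (1 / real c)"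
    using \<beta> \<beta>1 by (intro mult_mono) (auto simp: ge_one_powr_ge_zero)
  then have \<kappa>: "1 \<le> ln \<beta> * \<beta> powr (1 / real c)" by simp
  then have \<Gamma>: "0 < \<Gamma>" unfolding \<Gamma>_def using par(1) by (intro mult_pos_pos[of "_ * _"]) auto
  have valid: "valid_instance I" and mc: "min_capacity I = c"
    using I by (auto simp: integer_instances_def instances_def)
  have cap: "c \<le> capacity I i" if "i \<in> {1..num_servers I}" for i
    using that by (auto simp: min_capacity_def simp flip: mc)
  have "c \<in> capacity I ` {1..num_servers I}"
    unfolding mc[symmetric] min_capacity_def using valid
    by (intro Min_in) (auto simp: valid_instance_def)
  then have c1: "1 \<le> c" using valid by (auto simp: valid_instance_def)
  have run: "flb_run I a \<eta> \<beta> R D" if "a \<in> set_pmf (ALG I)" for a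
    using flb_run_of_integer_instance[OF FLB I that par(1) \<beta>1 par(3)] .
  have "OPT I \<in> total_reward I ` {a. feasible I a}"
    unfolding OPT_def using finite_feasible[OF valid] feasible_None by (intro Max_in) auto
  then obtain b where b: "feasible I b" "OPT I = total_reward I b" by auto
  \<comment> \<open>The lower bound holds for every outcome and therefore carries over to the
    expectation.\<close>
  have le: "OPT I / \<Gamma> \<le> total_reward I a" if "a \<in> set_pmf (ALG I)" for a
  proof -
    interpret flb_run I a \<eta> \<beta> R D using that by (rule run)
    have "OPT I \<le> \<Gamma> * total_reward I a"
      unfolding b(2) \<Gamma>_def using capacity_root_beta[OF c1 cap] by (intro competitive b(1) \<kappa>)
    then show ?thesis using \<Gamma> by (simp add: field_simps)
  qed
  have "finite (set_pmf (ALG I))"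
    by (rule finite_subset[OF _ finite_feasible[OF valid]]) (auto intro: flb_run.feasible_run run)
  then have "integrable (measure_pmf (ALG I)) (total_reward I)"
    by (rule integrable_measure_pmf_finite)
  then have "measure_pmf.expectation (ALG I) (\<lambda>_. OPT I / \<Gamma>) \<le> E"
    unfolding E_def using le by (intro integral_mono_AE) (auto simp: AE_measure_pmf_iff)
  then have OE: "OPT I \<le> \<Gamma> * E" using \<Gamma> by (simp add: field_simps)
  have "total_reward I (\<lambda>_. None) \<le> OPT I"
    unfolding OPT_def using finite_feasible[OF valid] feasible_None by (intro Max_ge) auto
  then have O0: "0 \<le> OPT I" by (simp add: total_reward_def)
  have "ereal (OPT I) / ereal E \<le> ereal \<Gamma>"
  proof (cases "E = 0")
    \<comment> \<open>If the expected reward vanishes, so does the optimum, and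
      \<open>0 / 0 = 0\<close> in the extended reals.\<close>
    case True
    then have "OPT I = 0" using OE O0 by simp
    then show ?thesis using True \<Gamma> by (simp add: zero_ereal_def[symmetric])
  next
    case False
    have "0 \<le> \<Gamma> * E" using OE O0 by linarith
    then have "0 < E" using False \<Gamma> by (simp add: zero_le_mult_iff)
    then show ?thesis using OE by (simp add: field_simps)
  qed
  then show ?thesis by (simp add: E_def \<Gamma>_def)
qed

theorem FLB_asymptotically_competitive:
  assumes FLB: "is_FLB 1 \<eta> \<beta> ALG"
    and par: "0 < \<eta>" "exp 1 \<le> \<beta>" "R * D \<le> \<eta> * (\<beta> - 1)"
  shows "asymptotically_competitive (integer_instances R D) ALG (ln \<beta> * (1 + \<eta>))"
  unfolding asymptotically_competitive_def
proof (intro conjI allI ballI)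
  have \<beta>: "1 \<le> \<beta>" using par(2) exp_ge_add_one_self[of 1] by linarith
  fix c I a assume "I \<in> integer_instances R D c" "a \<in> set_pmf (ALG I)"
  then show "feasible I a"
    using flb_run_of_integer_instance[OF FLB _ _ par(1) \<beta> par(3)] flb_run.feasible_run by blast
next
  have \<beta>: "0 < \<beta>" using par(2) exp_gt_zero[of "1::real"] by linarith
  \<comment> \<open>\<open>\<beta>\<close> stays fixed as \<open>c\<close> grows, so the error
    factor tends to 1.\<close>
  have "(\<lambda>c. 1 / real c) \<longlonglongrightarrow> 0" by (rule lim_1_over_n)
  then have "(\<lambda>c. ln \<beta> * \<beta> powr (1 / real c) * (1 + \<eta>)) \<longlonglongrightarrow> ln \<beta> * \<beta> powr 0 * (1 + \<eta>)"
    using \<beta> by (intro tendsto_intros) auto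
  then have "(\<lambda>c. ereal (ln \<beta> * \<beta> powr (1 / real c) * (1 + \<eta>)))
      \<longlonglongrightarrow> ereal (ln \<beta> * (1 + \<eta>))"
    using \<beta> by simp
  then have lim: "limsup (\<lambda>c. ereal (ln \<beta> * \<beta> powr (1 / real c) * (1 + \<eta>)))
      = ereal (ln \<beta> * (1 + \<eta>))"
    by (intro lim_imp_Limsup) auto
  have "asymptotic_ratio (integer_instances R D) ALG
      \<le> limsup (\<lambda>c. ereal (ln \<beta> * \<beta> powr (1 / real c) * (1 + \<eta>)))"
    unfolding asymptotic_ratio_def
    by (intro Limsup_mono always_eventually allI SUP_least FLB_instance_ratio[OF FLB _ par])
  then show "asymptotic_ratio (integer_instances R D) ALG \<le> ereal (ln \<beta> * (1 + \<eta>))"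
    by (simp add: lim)
qed

lemma asymptotically_competitive_mono:
  assumes "asymptotically_competitive \<I> ALG \<Gamma>" "\<Gamma> \<le> \<Gamma>'"
  shows "asymptotically_competitive \<I> ALG \<Gamma>'"
  using assms by (auto simp: asymptotically_competitive_def intro: order_trans)

section \<open>Choice of parameters\<close>

text \<open>For \<open>\<beta> = 1 + R * D * (2 + L)\<close> and
  \<open>\<eta> = 1 / (2 + L)\<close>, \<open>ln \<beta>\<close> is at most
  \<open>L + ln (3 + L)\<close>, where the second term is a double logarithm up to a constant, and
  \<open>\<eta> * ln \<beta>\<close> is at most 2.\<close>

lemma FLB_parameter_estimate:
  fixes K R D L :: real
  assumes K: "1 < K" and RD: "1 \<le> R" "1 \<le> D" "K \<le> max R D" and L_def: "L = ln (R * D)"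
  shows "ln (1 + R * D * (2 + L)) * (1 + 1 / (2 + L))
    \<le> ln (R * D) + ln (ln (max R D)) + (ln (3 / ln K + 2) + 2)"
proof -
  have RD1: "1 \<le> R * D" using mult_mono[of 1 R 1 D] RD by simp
  have L0: "0 \<le> L" using RD1 by (simp add: L_def)
  let ?M = "ln (max R D)"
  have lK: "0 < ln K" using K by simp
  have M: "ln K \<le> ?M" using K RD by simp
  have "L = ln R + ln D" unfolding L_def using RD by (simp add: ln_mult)
  moreover have "ln R \<le> ?M" "ln D \<le> ?M" using RD by (auto intro!: ln_mono)
  ultimately have "L \<le> 2 * ?M" by simp
  \<comment> \<open>The constant 3 is absorbed into a multiple of \<open>?M\<close>, which is
    possible because \<open>?M\<close> is at least \<open>ln K > 0\<close>.\<close>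
  moreover have "3 \<le> 3 / ln K * ?M" using lK M by (simp add: field_simps)
  ultimately have "3 + L \<le> (3 / ln K + 2) * ?M" by (simp add: algebra_simps)
  then have "ln (3 + L) \<le> ln ((3 / ln K + 2) * ?M)" using L0 by (intro ln_mono) auto
  also have "\<dots> = ln (3 / ln K + 2) + ln ?M"
  proof (rule ln_mult_pos)
    show "0 < 3 / ln K + 2" using lK by (simp add: add_pos_pos)
    show "0 < ?M" using lK M by linarith
  qed
  finally have l3: "ln (3 + L) \<le> ln (3 / ln K + 2) + ln ?M" .
  have "0 \<le> R * D * (2 + L)" using RD1 L0 by (intro mult_nonneg_nonneg[of "R * D"]) auto
  then have "ln (1 + R * D * (2 + L)) \<le> ln (R * D * (3 + L))"
    using RD1 by (intro ln_mono) (auto simp: algebra_simps)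
  also have "\<dots> = L + ln (3 + L)" unfolding L_def[symmetric]
    using RD1 L0 L_def by (subst ln_mult_pos) linarith+
  finally have lb: "ln (1 + R * D * (2 + L)) \<le> L + ln (3 + L)" .
  have "ln (3 + L) \<le> 2 + L" using L0 ln_le_minus_one[of "3 + L"] by simp
  then have "L + ln (3 + L) \<le> 2 * (2 + L)" by simp
  with lb have "ln (1 + R * D * (2 + L)) \<le> 2 * (2 + L)" by (rule order_trans)
  then have "ln (1 + R * D * (2 + L)) / (2 + L) \<le> 2" using L0 by (simp add: pos_divide_le_eq)
  then have "ln (1 + R * D * (2 + L)) + ln (1 + R * D * (2 + L)) / (2 + L)
      \<le> (L + (ln (3 / ln K + 2) + ln ?M)) + 2"
    using lb l3 by (intro add_mono[of _ _ _ 2]) auto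
  then show ?thesis by (simp add: distrib_left L_def)
qed

text \<open>The term O(1) is read as a constant that depends on \<open>K\<close> alone. The bound
  \<open>K\<close> keeps \<open>max R D\<close> away from 1, where the double logarithm tends to
  minus infinity.\<close>

theorem theorem2:
  fixes K :: real
  assumes "1 < K"
  shows "\<exists>C::real. \<forall>R D :: real. 1 \<le> R \<longrightarrow> 1 \<le> D \<longrightarrow> K \<le> max R D \<longrightarrow>
    (\<exists>\<eta> \<beta> :: real. 0 \<le> \<eta> \<and> 1 \<le> \<beta> \<and>
      (\<forall>ALG. is_FLB 1 \<eta> \<beta> ALG \<longrightarrow>
        asymptotically_competitive (integer_instances R D) ALG
          (ln (R * D) + ln (ln (max R D)) + C)))"
proof (rule exI[of _ "ln (3 / ln K + 2) + 2"], intro allI impI)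
  fix R D :: real
  assume RD: "1 \<le> R" "1 \<le> D" "K \<le> max R D"
  define L where "L = ln (R * D)"
  \<comment> \<open>Of order \<open>1 / ln (R * D)\<close>, so that
    \<open>\<eta> * ln \<beta>\<close> stays bounded; the summand 2 keeps the denominator positive
    when \<open>R * D = 1\<close>.\<close>
  define \<eta> where "\<eta> = 1 / (2 + L)"
  \<comment> \<open>The least \<open>\<beta>\<close> allowed by saturation:
    \<open>\<eta> * (\<beta> - 1) = R * D\<close>.\<close>
  define \<beta> where "\<beta> = 1 + R * D * (2 + L)"
  have RD1: "1 \<le> R * D" using mult_mono[of 1 R 1 D] RD by simp
  have L0: "0 \<le> L" using RD1 by (simp add: L_def)
  have "1 * 2 \<le> R * D * (2 + L)" using RD1 L0 by (intro mult_mono) auto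
  then have \<beta>3: "3 \<le> \<beta>" by (simp add: \<beta>_def)
  have \<eta>: "0 < \<eta>" using L0 by (simp add: \<eta>_def)
  have e: "exp 1 \<le> \<beta>" using \<beta>3 exp_le by linarith
  have sat: "R * D \<le> \<eta> * (\<beta> - 1)" using L0 by (simp add: \<eta>_def \<beta>_def)
  have "asymptotically_competitive (integer_instances R D) ALG
      (ln (R * D) + ln (ln (max R D)) + (ln (3 / ln K + 2) + 2))" if "is_FLB 1 \<eta> \<beta> ALG" for ALG
    using FLB_asymptotically_competitive[OF that \<eta> e sat] FLB_parameter_estimate[OF assms RD L_def]
    by (auto simp: \<eta>_def \<beta>_def intro: asymptotically_competitive_mono)
  then show "\<exists>\<eta> \<beta>. 0 \<le> \<eta> \<and> 1 \<le> \<beta> \<and> (\<forall>ALG. is_FLB 1 \<eta> \<beta> ALG \<longrightarrow>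
      asymptotically_competitive (integer_instances R D) ALG
        (ln (R * D) + ln (ln (max R D)) + (ln (3 / ln K + 2) + 2)))"
    using \<eta> \<beta>3 by (intro exI[of _ \<eta>] exI[of _ \<beta>]) auto
qed

end
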